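(* Let $(X,d)$ be a compact metric space, let $\emptyset\neq F\subseteq X$ be equipped with a representation $(\tilde F_k)_{k\in\mathbb N}$, and let $F$ be explicitly closed (with respect to this representation). Let $(x_n)$ be a sequence in $X$, let $S(n,k)$ be a property of pairs $(n,k)\in\mathbb N^2$ that is monotone in $k$, and let $G,H:[0,\infty)\to[0,\infty)$ be functions possessing moduli $\alpha_G,\beta_H$. Assume that $(x_n)$ is locally $S$-relativized $(G,H)$-Fejér monotone with respect to $F$ and that $(x_n)$ has approximate $F/S$-points. Then $(x_n)$ converges to a point $x\in F$.
   Context: $\mathbb N=\{0,1,2,\dots\}$. $\overline B(p,r)$ denotes the closed ball. Representation: a family $(\tilde F_k)_{k\in\mathbb N}$ of subsets of $X$ with $F=\bigcap_{k\in\mathbb N}\tilde F_k$. Put $AF_k:=\bigcap_{l\le k}\tilde F_l$. Explicitly closed: $F$ is explicitly closed if for all $p\in X$: if $AF_M\cap\overline B\left(p,\frac1{N+1}\right)\neq\emptyset$ for all $N,M\in\mathbb N$, then $p\in F$. Monotonicity of $S$: for all $n,k_1,k_2\in\mathbb N$, if $k_1\le k_2$ and $S(n,k_2)$, then $S(n,k_1)$. Approximate $F/S$-points: $(x_n)$ has approximate $F/S$-points if for every $k\in\mathbb N$ there is $n\in\mathbb N$ with $x_n\in AF_k$ and $S(n,k)$. Moduli: $\alpha_G,\beta_H:\mathbb N\to\mathbb N$ are such that for all $k\in\mathbb N$ and $a\in[0,\infty)$: $a\le\frac1{\alpha_G(k)+1}$ implies $G(a)\le\frac1{k+1}$, and $H(a)\le\frac1{\beta_H(k)+1}$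 implies $a\le\frac1{k+1}$. Locally $S$-relativized $(G,H)$-Fejér monotone w.r.t. $F$: for all $p\in F$ and $r\in\mathbb N$ there is $m\in\mathbb N$ such that for all $n\in\mathbb N$: if $d(x_n,p)<\frac1{m+1}$ and $S(n,m)$, then $H(d(x_{n+l},p))\le G(d(x_n,p))+\frac1{r+1}$ for all $l\in\mathbb N$. *)

theory Defs
  imports "HOL-Analysis.Analysis"
begin

text \<open>
  Metric spaces are carrier-based (locale \<^locale>\<open>Metric_space\<close>, with carrier \<open>M\<close> and metric \<open>d\<close>).
  A function \<open>[0,\<infinity>) \<rightarrow> [0,\<infinity>)\<close> is a function of type \<^typ>\<open>real \<Rightarrow> real\<close> mapping
  nonnegative reals to nonnegative reals; its values at negative arguments are never used.
\<close>

definition AF :: "(nat \<Rightarrow> 'a set) \<Rightarrow> nat \<Rightarrow> 'a set" where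
  "AF Ft k = (\<Inter>l\<in>{..k}. Ft l)"

definition representation :: "'a set \<Rightarrow> (nat \<Rightarrow> 'a set) \<Rightarrow> 'a set \<Rightarrow> bool" where
  "representation X Ft F \<longleftrightarrow> (\<forall>k. Ft k \<subseteq> X) \<and> F = (\<Inter>k. Ft k)"

definition monotone_property :: "(nat \<Rightarrow> nat \<Rightarrow> bool) \<Rightarrow> bool" where
  "monotone_property S \<longleftrightarrow> (\<forall>n k1 k2. k1 \<le> k2 \<and> S n k2 \<longrightarrow> S n k1)"

definition approximate_FS_points ::
    "(nat \<Rightarrow> 'a set) \<Rightarrow> (nat \<Rightarrow> nat \<Rightarrow> bool) \<Rightarrow> (nat \<Rightarrow> 'a) \<Rightarrow> bool" where
  "approximate_FS_points Ft S x \<longleftrightarrow> (\<forall>k. \<exists>n. x n \<in> AF Ft k \<and> S n k)"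

definition G_modulus :: "(nat \<Rightarrow> nat) \<Rightarrow> (real \<Rightarrow> real) \<Rightarrow> bool" where
  "G_modulus \<alpha> G \<longleftrightarrow>
     (\<forall>k. \<forall>a\<ge>0. a \<le> 1 / (real (\<alpha> k) + 1) \<longrightarrow> G a \<le> 1 / (real k + 1))"

definition H_modulus :: "(nat \<Rightarrow> nat) \<Rightarrow> (real \<Rightarrow> real) \<Rightarrow> bool" where
  "H_modulus \<beta> H \<longleftrightarrow>
     (\<forall>k. \<forall>a\<ge>0. H a \<le> 1 / (real (\<beta> k) + 1) \<longrightarrow> a \<le> 1 / (real k + 1))"

context Metric_space
begin

definition explicitly_closed :: "(nat \<Rightarrow> 'a set) \<Rightarrow> 'a set \<Rightarrow> bool" where
  "explicitly_closed Ft F \<longleftrightarrow>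
     (\<forall>p\<in>M. (\<forall>N K. AF Ft K \<inter> mcball p (1 / (real N + 1)) \<noteq> {}) \<longrightarrow> p \<in> F)"

definition locally_relativized_Fejer_monotone ::
    "(nat \<Rightarrow> nat \<Rightarrow> bool) \<Rightarrow> (real \<Rightarrow> real) \<Rightarrow> (real \<Rightarrow> real) \<Rightarrow> 'a set \<Rightarrow> (nat \<Rightarrow> 'a) \<Rightarrow> bool" where
  "locally_relativized_Fejer_monotone S G H F x \<longleftrightarrow>
     (\<forall>p\<in>F. \<forall>r::nat. \<exists>m::nat. \<forall>n. d (x n) p < 1 / (real m + 1) \<and> S n m \<longrightarrow>
        (\<forall>l. H (d (x (n + l)) p) \<le> G (d (x n) p) + 1 / (real r + 1)))"

end

end

theory Submission
  imports Defs
begin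

text \<open>Compactness is applied to a sequence \<open>x (n k)\<close> of approximate points. Explicit closedness puts its
  cluster point \<open>p\<close> into \<open>F\<close>, and local Fejer monotonicity at \<open>p\<close>, started from an approximate
  point close to \<open>p\<close>, keeps the whole tail of \<open>x\<close> close to \<open>p\<close>.\<close>

lemma AF_antimono: "k \<le> l \<Longrightarrow> AF Ft l \<subseteq> AF Ft k"
  by (auto simp: AF_def)

context Metric_space
begin

text \<open>The sets \<open>AF Ft K\<close> decrease in \<open>K\<close>, so a term of
  \<open>y\<close> with index beyond both \<open>K\<close> and the threshold for the radius
  \<open>1 / (real N + 1)\<close> lies in both sets whose intersection has to be nonempty.\<close>

lemma explicitly_closed_limit:
  assumes "explicitly_closed Ft F"
    and lim: "limitin mtopology y p sequentially"
    and y: "\<And>k. y k \<in> AF Ft k"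
  shows "p \<in> F"
proof -
  have pM: "p \<in> M"
    using lim by (simp add: limit_metric_sequentially)
  have "AF Ft K \<inter> mcball p (1 / (real N + 1)) \<noteq> {}" for N K
  proof -
    have "1 / (real N + 1) > 0"
      by simp
    then obtain j where j: "\<And>n. n \<ge> j \<Longrightarrow> y n \<in> M \<and> d (y n) p < 1 / (real N + 1)"
      using lim unfolding limit_metric_sequentially by blast
    have "y (max j K) \<in> mcball p (1 / (real N + 1))"
      using j[of "max j K"] pM by (auto simp: commute)
    moreover have "y (max j K) \<in> AF Ft K"
      using y AF_antimono[of K "max j K" Ft] by auto
    ultimately show ?thesis
      by blast
  qed
  then show ?thesis
    using assms(1) pM unfolding explicitly_closed_def by blast
qed

text \<open>Closeness to \<open>p\<close> at the single index \<open>n\<close> controls all later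
  terms: \<open>G_modulus\<close> makes the right side of the Fejer inequality small, and
  \<open>H_modulus\<close> turns a small value of \<open>H\<close> back into a small distance. The
  number \<open>m\<close> is fixed before \<open>n\<close>.\<close>

lemma locally_relativized_Fejer_monotone_tail_bound:
  assumes G: "G_modulus \<alpha> G" and H: "H_modulus \<beta> H"
    and Fejer: "locally_relativized_Fejer_monotone S G H F x"
    and "p \<in> F"
  obtains m where "\<And>n l. \<lbrakk>d (x n) p < 1 / (real m + 1); S n m; d (x n) p \<le> 1 / (real (\<alpha> (2 * \<beta> k + 1)) + 1)\<rbrakk>
    \<Longrightarrow> d (x (n + l)) p \<le> 1 / (real k + 1)"
proof -
  \<comment> \<open>With this choice \<open>1 / (real ?r + 1)\<close> is half of
    \<open>1 / (real (\<beta> k) + 1)\<close>: one half pays for the value of \<open>G\<close>, the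
    other for the Fejer error.\<close>
  let ?r = "2 * \<beta> k + 1"
  obtain m where m: "\<And>n l. \<lbrakk>d (x n) p < 1 / (real m + 1); S n m\<rbrakk>
      \<Longrightarrow> H (d (x (n + l)) p) \<le> G (d (x n) p) + 1 / (real ?r + 1)"
    using Fejer \<open>p \<in> F\<close> unfolding locally_relativized_Fejer_monotone_def by blast
  show ?thesis
  proof (rule that)
    fix n l
    assume n: "d (x n) p < 1 / (real m + 1)" "S n m" "d (x n) p \<le> 1 / (real (\<alpha> ?r) + 1)"
    have "G (d (x n) p) \<le> 1 / (real ?r + 1)"
      using G n(3) nonneg unfolding G_modulus_def by blast
    then have "H (d (x (n + l)) p) \<le> 1 / (real ?r + 1) + 1 / (real ?r + 1)"
      using m[OF n(1,2), of l] by linarith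
    also have "\<dots> = 1 / (real (\<beta> k) + 1)"
      by (simp add: field_simps)
    finally show "d (x (n + l)) p \<le> 1 / (real k + 1)"
      using H unfolding H_modulus_def using nonneg by blast
  qed
qed

text \<open>One index \<open>n i\<close> with \<open>x (n i)\<close> close enough to
  \<open>p\<close> traps the whole tail of \<open>x\<close> from there on, so the map
  \<open>n\<close> may be any choice of indices, increasing or not.\<close>

lemma locally_relativized_Fejer_monotone_limit:
  assumes G: "G_modulus \<alpha> G" and H: "H_modulus \<beta> H"
    and Fejer: "locally_relativized_Fejer_monotone S G H F x"
    and "p \<in> F" and x: "\<And>n. x n \<in> M"
    and lim: "limitin mtopology (\<lambda>k. x (n k)) p sequentially"
    and S: "monotone_property S" "\<And>k. S (n k) k"
  shows "limitin mtopology x p sequentially"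
  unfolding limit_metric_sequentially
proof (intro conjI allI impI)
  show "p \<in> M"
    using lim by (simp add: limit_metric_sequentially)
  fix \<epsilon> :: real
  assume "\<epsilon> > 0"
  then obtain k where k: "1 / (real k + 1) < \<epsilon>"
    using reals_Archimedean[of \<epsilon>] by (auto simp: field_simps)
  obtain m where m: "\<And>n l. \<lbrakk>d (x n) p < 1 / (real m + 1); S n m; d (x n) p \<le> 1 / (real (\<alpha> (2 * \<beta> k + 1)) + 1)\<rbrakk>
      \<Longrightarrow> d (x (n + l)) p \<le> 1 / (real k + 1)"
    using locally_relativized_Fejer_monotone_tail_bound[OF G H Fejer \<open>p \<in> F\<close>] by blast
  \<comment> \<open>The first radius is where the Fejer inequality applies, the second is what the
    modulus of \<open>G\<close> asks for.\<close>
  let ?\<delta> = "min (1 / (real m + 1)) (1 / (real (\<alpha> (2 * \<beta> k + 1)) + 1))"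
  have "?\<delta> > 0"
    by simp
  then obtain j where j: "\<And>i. i \<ge> j \<Longrightarrow> d (x (n i)) p < ?\<delta>"
    using lim unfolding limit_metric_sequentially by blast
  \<comment> \<open>Being at least \<open>j\<close> gives closeness to \<open>p\<close>; being at
    least \<open>m\<close> lets monotonicity lower \<open>S (n ?i) ?i\<close> to
    \<open>S (n ?i) m\<close>.\<close>
  let ?i = "max j m"
  have "S (n ?i) m"
    using S(1) S(2)[of ?i] max.cobounded2[of m j] unfolding monotone_property_def by blast
  then have tail: "d (x (n ?i + l)) p < \<epsilon>" for l
    using m[of "n ?i" l] j[of ?i] k \<open>S (n ?i) m\<close> by simp
  have "x i \<in> M \<and> d (x i) p < \<epsilon>" if "i \<ge> n ?i" for i
    using tail[of "i - n ?i"] that x by simp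
  then show "\<exists>N. \<forall>i\<ge>N. x i \<in> M \<and> d (x i) p < \<epsilon>"
    by blast
qed

end

theorem theorem2p5:
  fixes X :: "'a set"
    and d :: "'a \<Rightarrow> 'a \<Rightarrow> real"
    and F :: "'a set"
    and Ft :: "nat \<Rightarrow> 'a set"
    and x :: "nat \<Rightarrow> 'a"
    and S :: "nat \<Rightarrow> nat \<Rightarrow> bool"
    and G H :: "real \<Rightarrow> real"
    and \<alpha>\<^sub>G \<beta>\<^sub>H :: "nat \<Rightarrow> nat"
  assumes "Metric_space X d"
    and "compact_space (Metric_space.mtopology X d)"
    and "F \<noteq> {}" and "F \<subseteq> X"
    and "representation X Ft F"
    and "Metric_space.explicitly_closed X d Ft F"
    and "\<And>n. x n \<in> X"
    and "monotone_property S"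
    and "G \<in> {0..} \<rightarrow> {0..}" and "H \<in> {0..} \<rightarrow> {0..}"
    and "G_modulus \<alpha>\<^sub>G G" and "H_modulus \<beta>\<^sub>H H"
    and "Metric_space.locally_relativized_Fejer_monotone d S G H F x"
    and "approximate_FS_points Ft S x"
  shows "\<exists>p\<in>F. limitin (Metric_space.mtopology X d) x p sequentially"
proof -
  interpret Metric_space X d by fact
  obtain n where n: "\<And>k. x (n k) \<in> AF Ft k" "\<And>k. S (n k) k"
    using \<open>approximate_FS_points Ft S x\<close> unfolding approximate_FS_points_def by metis
  obtain p r where r: "strict_mono r" and lim: "limitin mtopology (\<lambda>k. x (n (r k))) p sequentially"
  proof -
    have "range (\<lambda>k. x (n k)) \<subseteq> X"
      using assms(7) by blast
    then obtain p r where "strict_mono r" "limitin mtopology ((\<lambda>k. x (n k)) \<circ> r) p sequentially"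
      using \<open>compact_space mtopology\<close> unfolding compact_space_sequentially by blast
    then show ?thesis
      using that by (simp add: comp_def)
  qed
  \<comment> \<open>Passing to the subsequence keeps the approximation quality: level
    \<open>r k\<close> is at least level \<open>k\<close>, both for \<open>AF\<close> and for
    \<open>S\<close>.\<close>
  have le: "k \<le> r k" for k
    by (rule strict_mono_imp_increasing[OF r])
  have "x (n (r k)) \<in> AF Ft k" for k
    using AF_antimono[OF le[of k]] n(1)[of "r k"] by (rule subsetD)
  then have "p \<in> F"
    by (rule explicitly_closed_limit[OF assms(6) lim])
  have "S (n (r k)) k" for k
    using \<open>monotone_property S\<close> n(2)[of "r k"] le[of k] unfolding monotone_property_def by blast
  then have "limitin mtopology x p sequentially"
    by (rule locally_relativized_Fejer_monotone_limit[OF assms(11,12,13) \<open>p \<in> F\<close> assms(7) lim \<open>monotone_property S\<close>])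
  with \<open>p \<in> F\<close> show ?thesis ..
qed

end
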